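(* Let $X$ be a real Banach space and let $M$ be a metric space. Suppose that $N_1\subset X$ is a Lipschitz retract of $X$ and $N_2\subset M$ is a Lipschitz retract of $M$ such that $X$ is Lipschitz equivalent to $N_2$ and $M$ is Lipschitz equivalent to $N_1$. Then $\mathcal{F}(X)\simeq \mathcal{F}(M)$.
   Context: For a pointed metric space $(M,d,0)$, $Lip_0(M)$ is the Banach space of all real-valued Lipschitz functions $f$ on $M$ with $f(0)=0$, with norm $\|f\|_{Lip}=\sup_{x\ne y}\frac{|f(x)-f(y)|}{d(x,y)}$. The Lipschitz-free space $\mathcal{F}(M)$ is the norm closure in $Lip_0(M)^*$ of the linear span of the evaluation functionals $\delta_x: f\mapsto f(x)$, $x\in M$. Different choices of base point give isometrically isomorphic spaces, so the base point need not be specified. A Banach space is regarded as a metric space with its norm distance. $\simeq$ denotes linear isomorphism of Banach spaces. A subset $F$ of a metric space $M$ is a Lipschitz retract of $M$ if there is a Lipschitz map from $M$ onto $F$ which is the identity on $F$. Two metric spaces are Lipschitz equivalent if there is a bi-Lipschitz map from one onto the other. *)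

theory Defs
  imports "HOL-Analysis.Analysis"
begin

(* A statement about 'a :: pointed_metric_space holds for every choice of the base point,
   since the class imposes no condition on it. On a normed space it need not be the origin. *)
class pointed_metric_space = metric_space +
  fixes basepoint :: 'a

typedef (overloaded) 'a lip0 =
    "{f :: 'a::pointed_metric_space \<Rightarrow> real. f basepoint = 0 \<and> (\<exists>L. L-lipschitz_on UNIV f)}"
  morphisms lip0_apply Lip0
  by (rule exI[of _ "\<lambda>_. 0"]) (auto intro: lipschitz_on_constant)

setup_lifting type_definition_lip0

instantiation lip0 :: (pointed_metric_space) real_vector
begin

lift_definition zero_lip0 :: "'a lip0" is "\<lambda>_. 0"
  by (auto intro: lipschitz_on_constant)

lift_definition plus_lip0 :: "'a lip0 \<Rightarrow> 'a lip0 \<Rightarrow> 'a lip0" is "\<lambda>f g x. f x + g x"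
  by (auto intro: lipschitz_on_add)

lift_definition minus_lip0 :: "'a lip0 \<Rightarrow> 'a lip0 \<Rightarrow> 'a lip0" is "\<lambda>f g x. f x - g x"
  by (auto intro: lipschitz_on_diff)

lift_definition uminus_lip0 :: "'a lip0 \<Rightarrow> 'a lip0" is "\<lambda>f x. - f x"
  by (auto intro: lipschitz_on_minus)

lift_definition scaleR_lip0 :: "real \<Rightarrow> 'a lip0 \<Rightarrow> 'a lip0" is "\<lambda>c f x. c * f x"
  by (auto intro: lipschitz_on_cmult_real)

instance
proof
  fix f g h :: "'a lip0" and a b :: real
  show "f + g + h = f + (g + h)" "f + g = g + f" "0 + f = f" "- f + f = 0" "f - g = f + - g"
    by (transfer; simp add: fun_eq_iff)+
  show "a *\<^sub>R (f + g) = a *\<^sub>R f + a *\<^sub>R g" "(a + b) *\<^sub>R f = a *\<^sub>R f + b *\<^sub>R f"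
    "a *\<^sub>R b *\<^sub>R f = (a * b) *\<^sub>R f" "1 *\<^sub>R f = f"
    by (transfer; simp add: fun_eq_iff algebra_simps)+
qed

end

instantiation lip0 :: (pointed_metric_space) real_normed_vector
begin

(* The pairs with x = y contribute 0 / 0 = 0. They do not affect the supremum, except that
   they make it 0 on a one-point space, where there are no pairs with x \<noteq> y. *)
lift_definition norm_lip0 :: "'a lip0 \<Rightarrow> real"
  is "\<lambda>f. SUP (x, y) \<in> UNIV. \<bar>f x - f y\<bar> / dist x y" .

definition dist_lip0 :: "'a lip0 \<Rightarrow> 'a lip0 \<Rightarrow> real"
  where "dist_lip0 f g = norm (f - g)"

definition sgn_lip0 :: "'a lip0 \<Rightarrow> 'a lip0"
  where "sgn_lip0 f = inverse (norm f) *\<^sub>R f"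

definition uniformity_lip0 :: "('a lip0 \<times> 'a lip0) filter"
  where "uniformity_lip0 = (INF e\<in>{0<..}. principal {(f, g). dist f g < e})"

definition open_lip0 :: "'a lip0 set \<Rightarrow> bool"
  where "open_lip0 U \<longleftrightarrow> (\<forall>f\<in>U. \<forall>\<^sub>F (f', g) in uniformity. f' = f \<longrightarrow> g \<in> U)"

lemma lip0_bdd_above: "bdd_above (range (\<lambda>(x, y). \<bar>lip0_apply f x - lip0_apply f y\<bar> / dist x y))"
proof -
  obtain L where L: "L-lipschitz_on UNIV (lip0_apply f)"
    using lip0_apply[of f] by auto
  show ?thesis
  proof (rule bdd_aboveI2[where M = L], clarify)
    fix x y
    show "\<bar>lip0_apply f x - lip0_apply f y\<bar> / dist x y \<le> L"
      using lipschitz_onD[OF L, of x y] lipschitz_on_nonneg[OF L]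
      by (cases "x = y") (auto simp: dist_real_def divide_le_eq)
  qed
qed

lemma lip0_apply_le_norm: "\<bar>lip0_apply f x - lip0_apply f y\<bar> \<le> norm f * dist x y"
proof (cases "x = y")
  case False
  have "\<bar>lip0_apply f x - lip0_apply f y\<bar> / dist x y \<le> norm f"
    unfolding norm_lip0.rep_eq
    by (rule cSUP_upper2[OF lip0_bdd_above, where x = "(x, y)"]) auto
  with False show ?thesis by (simp add: divide_le_eq)
qed simp

lemma lip0_norm_le:
  assumes "\<And>x y. \<bar>lip0_apply f x - lip0_apply f y\<bar> \<le> L * dist x y" "0 \<le> L"
  shows "norm f \<le> L"
  unfolding norm_lip0.rep_eq
proof (rule cSUP_least, simp, clarify)
  fix x y
  show "\<bar>lip0_apply f x - lip0_apply f y\<bar> / dist x y \<le> L"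
    using assms by (cases "x = y") (auto simp: divide_le_eq)
qed

lemma lip0_norm_nonneg: "0 \<le> norm (f :: 'a lip0)"
  unfolding norm_lip0.rep_eq
  by (rule cSUP_upper2[OF lip0_bdd_above, where x = "(basepoint, basepoint)"]) auto

lemma lip0_apply_basepoint: "lip0_apply f basepoint = 0"
  using lip0_apply[of f] by auto

instance
proof
  fix f g :: "'a lip0" and a :: real and U :: "'a lip0 set"
  show "dist f g = norm (f - g)" "sgn f = f /\<^sub>R norm f"
    by (simp_all add: dist_lip0_def sgn_lip0_def)
  show "(uniformity :: ('a lip0 \<times> 'a lip0) filter) = (INF e\<in>{0<..}. principal {(f, g). dist f g < e})"
    by (rule uniformity_lip0_def)
  show "open U \<longleftrightarrow> (\<forall>f\<in>U. \<forall>\<^sub>F (f', g) in uniformity. f' = f \<longrightarrow> g \<in> U)"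
    by (rule open_lip0_def)
  show "norm f = 0 \<longleftrightarrow> f = 0"
  proof
    assume "norm f = 0"
    then have "lip0_apply f x = 0" for x
      using lip0_apply_le_norm[of f x basepoint] by (simp add: lip0_apply_basepoint)
    then show "f = 0"
      by (simp add: lip0_apply_inject[symmetric] zero_lip0.rep_eq fun_eq_iff)
  next
    assume "f = 0"
    then show "norm f = 0"
      by (intro antisym lip0_norm_nonneg lip0_norm_le) (auto simp: zero_lip0.rep_eq)
  qed
  show "norm (f + g) \<le> norm f + norm g"
  proof (rule lip0_norm_le)
    fix x y
    show "\<bar>lip0_apply (f + g) x - lip0_apply (f + g) y\<bar> \<le> (norm f + norm g) * dist x y"
      using lip0_apply_le_norm[of f x y] lip0_apply_le_norm[of g x y]
      by (simp add: plus_lip0.rep_eq algebra_simps)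
  qed (simp add: lip0_norm_nonneg)
  have le: "norm (c *\<^sub>R k) \<le> \<bar>c\<bar> * norm k" for c and k :: "'a lip0"
  proof (rule lip0_norm_le)
    fix x y
    show "\<bar>lip0_apply (c *\<^sub>R k) x - lip0_apply (c *\<^sub>R k) y\<bar> \<le> \<bar>c\<bar> * norm k * dist x y"
      using mult_left_mono[OF lip0_apply_le_norm[of k x y], of "\<bar>c\<bar>"]
      by (simp add: scaleR_lip0.rep_eq abs_mult[symmetric] right_diff_distrib mult.assoc)
  qed (simp add: lip0_norm_nonneg)
  show "norm (a *\<^sub>R f) = \<bar>a\<bar> * norm f"
  proof (cases "a = 0")
    case True
    with le[of a f] lip0_norm_nonneg[of "a *\<^sub>R f"] show ?thesis by simp
  next
    case False
    have "inverse a *\<^sub>R a *\<^sub>R f = f"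
      using False by (transfer) (simp add: fun_eq_iff)
    with le[of "inverse a" "a *\<^sub>R f"] have "norm f \<le> \<bar>inverse a\<bar> * norm (a *\<^sub>R f)"
      by simp
    with False have "\<bar>a\<bar> * norm f \<le> norm (a *\<^sub>R f)"
      by (simp add: field_simps)
    with le[of a f] show ?thesis by simp
  qed
qed

end

lift_definition evaluation :: "'a::pointed_metric_space \<Rightarrow> 'a lip0 \<Rightarrow>\<^sub>L real"
  is "\<lambda>x f. lip0_apply f x"
proof (rule bounded_linear_intro)
  fix x :: 'a and f g :: "'a lip0" and r :: real
  show "lip0_apply (f + g) x = lip0_apply f x + lip0_apply g x"
    by (simp add: plus_lip0.rep_eq)
  show "lip0_apply (r *\<^sub>R f) x = r *\<^sub>R lip0_apply f x"
    by (simp add: scaleR_lip0.rep_eq)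
  show "norm (lip0_apply f x) \<le> norm f * dist x basepoint"
    using lip0_apply_le_norm[of f x basepoint] by (simp add: lip0_apply_basepoint)
qed

definition lipschitz_free :: "('a::pointed_metric_space lip0 \<Rightarrow>\<^sub>L real) set"
  where "lipschitz_free = closure (span (range evaluation))"

(* Intended for linear subspaces S and T with the norms induced from the ambient spaces;
   no condition is put on h and k outside S and T. *)
definition linearly_isomorphic ::
    "'a::real_normed_vector set \<Rightarrow> 'b::real_normed_vector set \<Rightarrow> bool"  (infix "\<simeq>\<^sub>l\<^sub>i\<^sub>n" 50)
  where "S \<simeq>\<^sub>l\<^sub>i\<^sub>n T \<longleftrightarrow> (\<exists>h k. homeomorphism S T h k \<and>
    (\<forall>x\<in>S. \<forall>y\<in>S. h (x + y) = h x + h y) \<and> (\<forall>c. \<forall>x\<in>S. h (c *\<^sub>R x) = c *\<^sub>R h x))"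

definition lipschitz_retract_of :: "'a::metric_space set \<Rightarrow> 'a set \<Rightarrow> bool"
    (infix "lipschitz'_retract'_of" 50)
  where "N lipschitz_retract_of M \<longleftrightarrow> N \<subseteq> M \<and>
    (\<exists>r L. L-lipschitz_on M r \<and> r ` M = N \<and> (\<forall>x\<in>N. r x = x))"

definition bi_lipschitz_on :: "'a::metric_space set \<Rightarrow> ('a \<Rightarrow> 'b::metric_space) \<Rightarrow> bool"
  where "bi_lipschitz_on S f \<longleftrightarrow> (\<exists>c>0. \<exists>C. \<forall>x\<in>S. \<forall>y\<in>S.
    c * dist x y \<le> dist (f x) (f y) \<and> dist (f x) (f y) \<le> C * dist x y)"

definition lipschitz_equivalent :: "'a::metric_space set \<Rightarrow> 'b::metric_space set \<Rightarrow> bool"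
  where "lipschitz_equivalent S T \<longleftrightarrow> (\<exists>f. bi_lipschitz_on S f \<and> f ` S = T)"

end

theory Submission
  imports Defs "HOL-Library.Function_Algebras"
begin

text \<open>
  The retractions and equivalences give Lipschitz maps i, r, j, q between X and M with
  r i = id on X and q j = id on M, so each of F(X) and F(M) is complemented in the other.
  By the decomposition method it is enough that the \<open>l\<^sub>1\<close>-sum of countably many copies of F(X) is
  complemented in F(X). Dually, a bounded sequence of functions on X is encoded in a single
  function: cut the k-th function by a partition of unity into pieces living on the dyadic annuli
  of radius about \<open>2\<^sup>n\<close>, shrink the piece by \<open>2\<^sup>-\<^sup>n\<close>, which preserves its Lipschitz constant, and
  put it into the (k, n)-th of countably many disjoint balls of X. Reading the pieces off again is
  a bounded left inverse of this encoding. All operators involved evaluate pointwise to finite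
  combinations of values, so they are adjoints of operators between the free spaces.
\<close>

section \<open>Operators between Lipschitz function spaces\<close>

text \<open>An operator T on functions whose functionals \<open>\<lambda>f. T f x\<close> are all finitary is weak*-continuous:
  its adjoint maps evaluations into the span of evaluations.\<close>

inductive finitary :: "(('a \<Rightarrow> real) \<Rightarrow> real) \<Rightarrow> bool" where
  eval: "finitary (\<lambda>f. f x)"
| zero: "finitary (\<lambda>f. 0)"
| add: "finitary \<phi> \<Longrightarrow> finitary \<psi> \<Longrightarrow> finitary (\<lambda>f. \<phi> f + \<psi> f)"
| scale: "finitary \<phi> \<Longrightarrow> finitary (\<lambda>f. c * \<phi> f)"

lemma finitary_diff:
  assumes "finitary \<phi>" "finitary \<psi>"
  shows "finitary (\<lambda>f. \<phi> f - \<psi> f)"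
  using finitary.add[OF assms(1) finitary.scale[OF assms(2), of "-1"]] by simp

lemma finitary_sum:
  assumes "\<And>i. i \<in> A \<Longrightarrow> finitary (\<phi> i)"
  shows "finitary (\<lambda>f. \<Sum>i\<in>A. \<phi> i f)"
  using assms by (induction A rule: infinite_finite_induct) (auto intro: finitary.intros)

lemma finitary_compose:
  assumes "finitary \<phi>" "\<And>x. finitary (\<lambda>f. T f x)"
  shows "finitary (\<lambda>f. \<phi> (T f))"
  using assms(1) by induction (auto intro: finitary.intros assms(2))

lemma finitary_linear:
  assumes "finitary \<phi>"
  shows "\<phi> (\<lambda>x. f x + g x) = \<phi> f + \<phi> g" "\<phi> (\<lambda>x. c * f x) = c * \<phi> f"
  using assms by (induction, auto simp: algebra_simps)

lemma finitary_in_span_evaluation: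
  assumes "finitary \<phi>"
  shows "\<exists>\<gamma>\<in>span (range evaluation). \<forall>f. blinfun_apply \<gamma> f = \<phi> (lip0_apply f)"
  using assms
proof induction
  case (eval x)
  then show ?case
    by (intro bexI[of _ "evaluation x"]) (auto simp: evaluation.rep_eq intro: span_base)
next
  case zero
  then show ?case by (intro bexI[of _ 0]) (auto intro: span_zero)
next
  case (add \<phi> \<psi>)
  then obtain \<gamma> \<delta> where "\<gamma> \<in> span (range evaluation)" "\<forall>f. blinfun_apply \<gamma> f = \<phi> (lip0_apply f)"
    "\<delta> \<in> span (range evaluation)" "\<forall>f. blinfun_apply \<delta> f = \<psi> (lip0_apply f)" by blast
  then show ?case
    by (intro bexI[of _ "\<gamma> + \<delta>"]) (auto simp: blinfun.add_left intro: span_add)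
next
  case (scale \<phi> c)
  then obtain \<gamma> where "\<gamma> \<in> span (range evaluation)" "\<forall>f. blinfun_apply \<gamma> f = \<phi> (lip0_apply f)"
    by blast
  then show ?case
    by (intro bexI[of _ "c *\<^sub>R \<gamma>"]) (auto simp: blinfun.scaleR_left intro: span_scale)
qed

text \<open>Operators act on plain functions, so sums and compositions stay pointwise. The bound
  \<open>C\<close> is explicit because a sequence of operators is stacked under a common
  bound.\<close>

definition lip0_op :: "real \<Rightarrow>
    (('a::pointed_metric_space \<Rightarrow> real) \<Rightarrow> 'b::pointed_metric_space \<Rightarrow> real) \<Rightarrow> bool"
  where "lip0_op C T \<longleftrightarrow> 0 \<le> C \<and> (\<forall>x. finitary (\<lambda>f. T f x)) \<and>
    (\<forall>L f. L-lipschitz_on UNIV f \<longrightarrow> f basepoint = 0 \<longrightarrow>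
      (C * L)-lipschitz_on UNIV (T f) \<and> T f basepoint = 0)"

lemma lip0_op_finitary: "lip0_op C T \<Longrightarrow> finitary (\<lambda>f. T f x)"
  and lip0_op_nonneg: "lip0_op C T \<Longrightarrow> 0 \<le> C"
  and lip0_op_lipschitz:
    "lip0_op C T \<Longrightarrow> L-lipschitz_on UNIV f \<Longrightarrow> f basepoint = 0 \<Longrightarrow> (C * L)-lipschitz_on UNIV (T f)"
  and lip0_op_basepoint:
    "lip0_op C T \<Longrightarrow> L-lipschitz_on UNIV f \<Longrightarrow> f basepoint = 0 \<Longrightarrow> T f basepoint = 0"
  by (auto simp: lip0_op_def)

lemma lip0_op_mono:
  assumes "lip0_op C T" "C \<le> D"
  shows "lip0_op D T"
proof -
  have "C * L \<le> D * L" if "L-lipschitz_on UNIV f" for L and f :: "'a \<Rightarrow> real"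
    using assms(2) lipschitz_on_nonneg[OF that] by (rule mult_right_mono)
  then show ?thesis
    using assms unfolding lip0_op_def by (meson lipschitz_on_le order.trans)
qed

lemma lip0_op_id: "lip0_op 1 (\<lambda>f. f)"
  by (auto simp: lip0_op_def intro: finitary.intros)

lemma lip0_op_compose:
  assumes "lip0_op C S" "lip0_op D T"
  shows "lip0_op (C * D) (\<lambda>f. S (T f))"
  unfolding lip0_op_def
proof (intro conjI allI impI)
  show "0 \<le> C * D" using assms by (simp add: lip0_op_nonneg)
  show "finitary (\<lambda>f. S (T f) x)" for x
    by (rule finitary_compose[OF lip0_op_finitary[OF assms(1)] lip0_op_finitary[OF assms(2)]])
  fix L and f :: "'c \<Rightarrow> real"
  assume f: "L-lipschitz_on UNIV f" "f basepoint = 0"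
  note Tf = lip0_op_lipschitz[OF assms(2) f] lip0_op_basepoint[OF assms(2) f]
  show "(C * D * L)-lipschitz_on UNIV (S (T f))" "S (T f) basepoint = 0"
    using lip0_op_lipschitz[OF assms(1) Tf] lip0_op_basepoint[OF assms(1) Tf]
    by (simp_all add: mult.assoc)
qed

lemma lip0_op_add:
  assumes "lip0_op C S" "lip0_op D T"
  shows "lip0_op (C + D) (\<lambda>f. S f + T f)"
  using assms unfolding lip0_op_def
  by (auto simp: plus_fun_def distrib_right intro!: finitary.add lipschitz_on_add)

lemma lip0_op_diff:
  assumes "lip0_op C S" "lip0_op D T"
  shows "lip0_op (C + D) (\<lambda>f. S f - T f)"
  using assms unfolding lip0_op_def
  by (auto simp: fun_diff_def distrib_right intro!: finitary_diff lipschitz_on_diff)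

section \<open>Adjoints acting on the free spaces\<close>

lemma lipschitz_on_lip0_apply: "(norm f)-lipschitz_on UNIV (lip0_apply f)"
  by (rule lipschitz_onI) (auto simp: dist_real_def lip0_apply_le_norm)

lemma bounded_linear_lip0_op:
  assumes "lip0_op C T"
  shows "bounded_linear (\<lambda>f. Lip0 (T (lip0_apply f)))"
    and "lip0_apply (Lip0 (T (lip0_apply f))) = T (lip0_apply f)"
proof -
  have app: "lip0_apply (Lip0 (T (lip0_apply f))) = T (lip0_apply f)" for f
    using lip0_op_lipschitz[OF assms lipschitz_on_lip0_apply lip0_apply_basepoint, of f]
      lip0_op_basepoint[OF assms lipschitz_on_lip0_apply lip0_apply_basepoint, of f]
    by (subst Lip0_inverse) auto
  then show "lip0_apply (Lip0 (T (lip0_apply f))) = T (lip0_apply f)" .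
  note lin = finitary_linear[OF lip0_op_finitary[OF assms]]
  show "bounded_linear (\<lambda>f. Lip0 (T (lip0_apply f)))"
  proof (rule bounded_linear_intro)
    fix f g :: "'a lip0" and c :: real
    have "T (lip0_apply (f + g)) = (\<lambda>x. T (lip0_apply f) x + T (lip0_apply g) x)"
      by (simp add: plus_lip0.rep_eq fun_eq_iff lin)
    then show "Lip0 (T (lip0_apply (f + g))) = Lip0 (T (lip0_apply f)) + Lip0 (T (lip0_apply g))"
      unfolding lip0_apply_inject[symmetric] app
        plus_lip0.rep_eq[of "Lip0 (T (lip0_apply f))" "Lip0 (T (lip0_apply g))"] .
    have "T (lip0_apply (c *\<^sub>R f)) = (\<lambda>x. c * T (lip0_apply f) x)"
      by (simp add: scaleR_lip0.rep_eq fun_eq_iff lin)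
    then show "Lip0 (T (lip0_apply (c *\<^sub>R f))) = c *\<^sub>R Lip0 (T (lip0_apply f))"
      unfolding lip0_apply_inject[symmetric] app
        scaleR_lip0.rep_eq[of c "Lip0 (T (lip0_apply f))"] .
    have "(C * norm f)-lipschitz_on UNIV (T (lip0_apply f))"
      by (rule lip0_op_lipschitz[OF assms lipschitz_on_lip0_apply lip0_apply_basepoint])
    then show "norm (Lip0 (T (lip0_apply f))) \<le> norm f * C"
      using lip0_op_nonneg[OF assms]
      by (intro lip0_norm_le) (auto simp: app lipschitz_on_def dist_real_def mult.commute)
  qed
qed

text \<open>Precomposition with the operator is continuous and, by finitariness, sends evaluations
  into the span of evaluations; hence it preserves the closure of that span.\<close>

lemma lip0_op_preadjoint:
  assumes "lip0_op C T" "\<gamma> \<in> lipschitz_free"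
  shows "\<gamma> o\<^sub>L Blinfun (\<lambda>f. Lip0 (T (lip0_apply f))) \<in> lipschitz_free"
proof -
  let ?T = "Blinfun (\<lambda>f. Lip0 (T (lip0_apply f)))"
  note app = bounded_linear_Blinfun_apply[OF bounded_linear_lip0_op(1)[OF assms(1)]]
  have bl: "bounded_linear (\<lambda>\<gamma> :: 'b lip0 \<Rightarrow>\<^sub>L real. \<gamma> o\<^sub>L ?T)"
    by (rule bounded_bilinear.bounded_linear_left[OF bounded_bilinear_blinfun_compose])
  have "evaluation x o\<^sub>L ?T \<in> span (range evaluation)" for x :: 'b
  proof -
    obtain \<delta> where \<delta>: "\<delta> \<in> span (range evaluation)"
      "\<forall>f. blinfun_apply \<delta> f = T (lip0_apply f) x"
      using finitary_in_span_evaluation[OF lip0_op_finitary[OF assms(1)]] by blast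
    then have "evaluation x o\<^sub>L ?T = \<delta>"
      by (intro blinfun_eqI)
        (simp add: app evaluation.rep_eq bounded_linear_lip0_op(2)[OF assms(1)])
    with \<delta> show ?thesis by simp
  qed
  then have "(\<lambda>\<gamma>. \<gamma> o\<^sub>L ?T) ` span (range evaluation) \<subseteq> span (range evaluation)"
    unfolding linear_span_image[OF bounded_linear.linear[OF bl], symmetric]
    by (intro span_minimal) auto
  then have "(\<lambda>\<gamma>. \<gamma> o\<^sub>L ?T) ` closure (span (range evaluation)) \<subseteq> closure (span (range evaluation))"
    by (intro image_closure_subset bounded_linear.continuous_on[OF bl] continuous_on_id closed_closure)
      (use closure_subset in blast)
  with assms(2) show ?thesis by (auto simp: lipschitz_free_def)
qed

text \<open>Adjoints reverse direction: precomposition with \<open>S\<close> is the map from the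
  free space of \<open>'a\<close> to that of \<open>'b\<close>, and precomposition with
  \<open>T\<close> is its inverse.\<close>

lemma lipschitz_free_isomorphic:
  fixes T :: "('a::pointed_metric_space \<Rightarrow> real) \<Rightarrow> 'b::pointed_metric_space \<Rightarrow> real"
  assumes "lip0_op C T" "lip0_op D S"
    and ST: "\<And>f. f basepoint = 0 \<Longrightarrow> S (T f) = f"
    and TS: "\<And>g. g basepoint = 0 \<Longrightarrow> T (S g) = g"
  shows "(lipschitz_free :: ('a lip0 \<Rightarrow>\<^sub>L real) set) \<simeq>\<^sub>l\<^sub>i\<^sub>n (lipschitz_free :: ('b lip0 \<Rightarrow>\<^sub>L real) set)"
proof -
  let ?T = "Blinfun (\<lambda>f. Lip0 (T (lip0_apply f)))"
  let ?S = "Blinfun (\<lambda>f. Lip0 (S (lip0_apply f)))"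
  note app = bounded_linear_Blinfun_apply[OF bounded_linear_lip0_op(1)]
  have "blinfun_apply ?S (blinfun_apply ?T f) = f" for f
    by (simp add: app[OF assms(1)] app[OF assms(2)] bounded_linear_lip0_op(2)[OF assms(1)]
        ST lip0_apply_basepoint lip0_apply_inverse)
  then have 1: "\<gamma> o\<^sub>L ?S o\<^sub>L ?T = \<gamma>" for \<gamma> :: "'a lip0 \<Rightarrow>\<^sub>L real"
    by (intro blinfun_eqI) simp
  have "blinfun_apply ?T (blinfun_apply ?S f) = f" for f
    by (simp add: app[OF assms(1)] app[OF assms(2)] bounded_linear_lip0_op(2)[OF assms(2)]
        TS lip0_apply_basepoint lip0_apply_inverse)
  then have 2: "\<gamma> o\<^sub>L ?T o\<^sub>L ?S = \<gamma>" for \<gamma> :: "'b lip0 \<Rightarrow>\<^sub>L real"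
    by (intro blinfun_eqI) simp
  have "homeomorphism lipschitz_free lipschitz_free (\<lambda>\<gamma> :: 'a lip0 \<Rightarrow>\<^sub>L real. \<gamma> o\<^sub>L ?S) (\<lambda>\<gamma>. \<gamma> o\<^sub>L ?T)"
    by (rule homeomorphismI)
      (auto simp: 1 2 intro!: lip0_op_preadjoint[OF assms(1)] lip0_op_preadjoint[OF assms(2)]
        bounded_linear.continuous_on[OF bounded_bilinear.bounded_linear_left[OF bounded_bilinear_blinfun_compose]]
        continuous_on_id)
  then show ?thesis
    unfolding linearly_isomorphic_def
    by (intro exI[of _ "\<lambda>\<gamma>. \<gamma> o\<^sub>L ?S"] exI[of _ "\<lambda>\<gamma>. \<gamma> o\<^sub>L ?T"])
      (auto intro!: blinfun_eqI simp: blinfun.add_left blinfun.scaleR_left)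
qed

text \<open>Subtracting the constant restores the value 0 at the base point, which \<open>h\<close>
  need not preserve.\<close>

definition pull :: "('a::pointed_metric_space \<Rightarrow> 'b) \<Rightarrow> ('b \<Rightarrow> real) \<Rightarrow> 'a \<Rightarrow> real"
  where "pull h f = (\<lambda>x. f (h x) - f (h basepoint))"

lemma pull_basepoint [simp]: "pull h f basepoint = 0"
  by (simp add: pull_def)

lemma pull_add: "pull h (f + g) = pull h f + pull h g"
  and pull_diff: "pull h (f - g) = pull h f - pull h g" "pull h (\<lambda>x. f x - g x) = pull h f - pull h g"
  by (simp_all add: pull_def fun_eq_iff)

lemma pull_pull:
  assumes "\<And>x. h (k x) = x" "f basepoint = 0"
  shows "pull k (pull h f) = f"
  using assms by (simp add: pull_def fun_eq_iff)

lemma lip0_op_pull: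
  assumes "L-lipschitz_on UNIV h"
  shows "lip0_op L (pull h)"
  unfolding lip0_op_def
proof (intro conjI allI impI)
  show "0 \<le> L" using assms by (rule lipschitz_on_nonneg)
  show "finitary (\<lambda>f. pull h f x)" for x
    unfolding pull_def by (intro finitary_diff finitary.eval)
  fix K and f :: "'b \<Rightarrow> real"
  assume f: "K-lipschitz_on UNIV f"
  have "(K * L)-lipschitz_on UNIV (f \<circ> h)"
    by (rule lipschitz_on_compose[OF assms lipschitz_on_subset[OF f]]) simp
  then show "(L * K)-lipschitz_on UNIV (pull h f)"
    by (simp add: pull_def lipschitz_on_def dist_real_def o_def mult.commute)
qed simp

section \<open>Gluing a sequence of Lipschitz functions\<close>

text \<open>Product rule: on the support of \<open>w\<close> the slope \<open>K / r\<close> meets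
  values of \<open>F\<close> of size at most \<open>L * r\<close>, so \<open>r\<close> cancels and
  the constant does not depend on the scale.\<close>

lemma lipschitz_on_bump_mult:
  fixes w F :: "'a::metric_space \<Rightarrow> real"
  assumes w: "(K / r)-lipschitz_on UNIV w" "\<And>x. \<bar>w x\<bar> \<le> 1" "\<And>x. w x \<noteq> 0 \<Longrightarrow> dist x p \<le> r"
    and F: "L-lipschitz_on UNIV F" "F p = 0" and "0 < r"
  shows "((K + 1) * L)-lipschitz_on UNIV (\<lambda>x. w x * F x)"
proof -
  have L: "0 \<le> L" and "0 \<le> K / r" using w(1) F(1) by (auto dest: lipschitz_on_nonneg)
  with \<open>0 < r\<close> have K: "0 \<le> K" by (simp add: zero_le_divide_iff)
  \<comment> \<open>One point in the ball suffices: the splitting below weights the difference of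
    \<open>w\<close> by \<open>F x\<close>, never by \<open>F y\<close>.\<close>
  have *: "\<bar>w x * F x - w y * F y\<bar> \<le> (K + 1) * L * dist x y" if "dist x p \<le> r" for x y
  proof -
    have "\<bar>F x\<bar> \<le> L * r"
      using lipschitz_onD[OF F(1), of x p] mult_left_mono[OF that L]
      by (simp add: F(2) dist_real_def)
    moreover have "\<bar>w x - w y\<bar> \<le> K / r * dist x y"
      using lipschitz_onD[OF w(1), of x y] by (simp add: dist_real_def)
    ultimately have "\<bar>F x\<bar> * \<bar>w x - w y\<bar> \<le> (L * r) * (K / r * dist x y)"
      by (intro mult_mono) (use L \<open>0 < r\<close> in auto)
    also have "\<dots> = K * L * dist x y" using \<open>0 < r\<close> by simp
    finally have 1: "\<bar>F x * (w x - w y)\<bar> \<le> K * L * dist x y" by (simp add: abs_mult)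
    have "\<bar>w y\<bar> * \<bar>F x - F y\<bar> \<le> 1 * (L * dist x y)"
      using lipschitz_onD[OF F(1), of x y] w(2)[of y] by (intro mult_mono) (auto simp: dist_real_def)
    then have 2: "\<bar>w y * (F x - F y)\<bar> \<le> L * dist x y" by (simp add: abs_mult)
    have "w x * F x - w y * F y = F x * (w x - w y) + w y * (F x - F y)"
      by (simp add: algebra_simps)
    with 1 2 show ?thesis by (simp add: algebra_simps)
  qed
  show ?thesis
  proof (rule lipschitz_onI)
    fix x y
    show "dist (w x * F x) (w y * F y) \<le> (K + 1) * L * dist x y"
    proof (cases "w x = 0 \<and> w y = 0")
      case True
      then show ?thesis using K L by simp
    next
      case False
      then have "dist x p \<le> r \<or> dist y p \<le> r" using w(3) by blast
      then show ?thesis using *[of x y] *[of y x]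
        by (auto simp: dist_real_def dist_commute abs_minus_commute)
    qed
  qed (use K L in simp)
qed

text \<open>Between \<open>x\<close> and \<open>y\<close> only the at most \<open>2 * N\<close>
  indices in \<open>A x \<union> A y\<close> contribute.\<close>

lemma lipschitz_on_locally_finite_sum:
  fixes g :: "'i \<Rightarrow> 'a::metric_space \<Rightarrow> real"
  assumes A: "\<And>x. finite (A x)" "\<And>x. card (A x) \<le> N"
    and g: "\<And>i. K-lipschitz_on UNIV (g i)" "\<And>i x. g i x \<noteq> 0 \<Longrightarrow> i \<in> A x"
  shows "(2 * real N * K)-lipschitz_on UNIV (\<lambda>x. \<Sum>i\<in>A x. g i x)"
proof (rule lipschitz_onI)
  have K: "0 \<le> K" using lipschitz_on_nonneg[OF g(1)] .
  then show "0 \<le> 2 * real N * K" by simp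
  fix x y
  have U: "(\<Sum>i\<in>A x \<union> A y. g i x) = (\<Sum>i\<in>A x. g i x)" "(\<Sum>i\<in>A x \<union> A y. g i y) = (\<Sum>i\<in>A y. g i y)"
    by (rule sum.mono_neutral_right; use A(1) g(2) in blast)+
  have "card (A x \<union> A y) \<le> 2 * N"
    using card_Un_le[of "A x" "A y"] A(2)[of x] A(2)[of y] by linarith
  then have c: "real (card (A x \<union> A y)) \<le> 2 * real N" by linarith
  have "\<bar>(\<Sum>i\<in>A x. g i x) - (\<Sum>i\<in>A y. g i y)\<bar> = \<bar>\<Sum>i\<in>A x \<union> A y. g i x - g i y\<bar>"
    by (simp add: sum_subtractf U)
  also have "\<dots> \<le> (\<Sum>i\<in>A x \<union> A y. \<bar>g i x - g i y\<bar>)" by (rule sum_abs)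
  also have "\<dots> \<le> (\<Sum>i\<in>A x \<union> A y. K * dist x y)"
    using lipschitz_onD[OF g(1)] by (intro sum_mono) (auto simp: dist_real_def)
  also have "\<dots> \<le> 2 * real N * K * dist x y"
    using mult_right_mono[OF c, of "K * dist x y"] K by (simp add: mult.assoc)
  finally show "dist (\<Sum>i\<in>A x. g i x) (\<Sum>i\<in>A y. g i y) \<le> 2 * real N * K * dist x y"
    by (simp add: dist_real_def)
qed


lemma lipschitz_on_patch:
  fixes w F :: "'i \<Rightarrow> 'a::metric_space \<Rightarrow> real"
  assumes "\<And>x. finite (A x)" "\<And>x. card (A x) \<le> N"
    and "\<And>i. (K / r i)-lipschitz_on UNIV (w i)" "\<And>i x. \<bar>w i x\<bar> \<le> 1"
    and "\<And>i x. w i x \<noteq> 0 \<Longrightarrow> i \<in> A x \<and> dist x (p i) \<le> r i" "\<And>i. 0 < r i"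
    and "\<And>i. L-lipschitz_on UNIV (F i)" "\<And>i. F i (p i) = 0"
  shows "(2 * real N * (K + 1) * L)-lipschitz_on UNIV (\<lambda>x. \<Sum>i\<in>A x. w i x * F i x)"
proof -
  have "((K + 1) * L)-lipschitz_on UNIV (\<lambda>x. w i x * F i x)" for i
    using assms(5) by (intro lipschitz_on_bump_mult[OF assms(3,4) _ assms(7,8,6)]) blast
  then have "(2 * real N * ((K + 1) * L))-lipschitz_on UNIV (\<lambda>x. \<Sum>i\<in>A x. w i x * F i x)"
    using assms(5) by (intro lipschitz_on_locally_finite_sum[OF assms(1,2)]) auto
  then show ?thesis by (simp add: mult.assoc)
qed

text \<open>The argument is scaled by \<open>s\<close> and the value by \<open>a = 1 / s\<close>, so
  slopes do not grow.\<close>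

lemma lipschitz_on_dilation:
  fixes g :: "'a::real_normed_vector \<Rightarrow> real"
  assumes g: "L-lipschitz_on UNIV g" and "a * s = 1" "0 < s"
  shows "L-lipschitz_on UNIV (\<lambda>x. a * (g (c + s *\<^sub>R (x - p)) - d))"
proof (rule lipschitz_onI)
  fix x y
  have a: "0 < a" using assms(2,3) by (metis zero_less_mult_pos2 zero_less_one)
  let ?u = "c + s *\<^sub>R (x - p)" and ?v = "c + s *\<^sub>R (y - p)"
  have "dist ?u ?v = s * dist x y"
    using \<open>0 < s\<close> by (simp add: dist_norm flip: scaleR_diff_right)
  with lipschitz_onD[OF g, of ?u ?v] have "\<bar>g ?u - g ?v\<bar> \<le> L * (s * dist x y)"
    by (simp add: dist_real_def)
  then have "a * \<bar>g ?u - g ?v\<bar> \<le> a * (L * (s * dist x y))"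
    using a by simp
  also have "\<dots> = (a * s) * (L * dist x y)" by (simp only: mult_ac)
  finally have "a * \<bar>g ?u - g ?v\<bar> \<le> L * dist x y" by (simp add: assms(2))
  moreover have "a * (g ?u - d) - a * (g ?v - d) = a * (g ?u - g ?v)"
    by (simp add: algebra_simps)
  ultimately show "dist (a * (g ?u - d)) (a * (g ?v - d)) \<le> L * dist x y"
    using a by (simp add: dist_real_def abs_mult)
qed (rule lipschitz_on_nonneg[OF g])

lemma lipschitz_on_radial:
  fixes p :: "'a::real_normed_vector"
  assumes h: "\<And>s t. \<bar>h s - h t\<bar> \<le> K * \<bar>s - t\<bar>" and "0 \<le> K" "0 \<le> a"
  shows "(K * a)-lipschitz_on UNIV (\<lambda>x. h (a * norm (x - p)) :: real)"
proof (rule lipschitz_onI)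
  fix x y
  have "\<bar>a * norm (x - p) - a * norm (y - p)\<bar> = a * \<bar>norm (x - p) - norm (y - p)\<bar>"
    using \<open>0 \<le> a\<close> by (simp add: abs_mult flip: right_diff_distrib)
  also have "\<dots> \<le> a * dist x y"
    using norm_triangle_ineq3[of "x - p" "y - p"] \<open>0 \<le> a\<close>
    by (intro mult_left_mono) (simp_all add: dist_norm)
  finally have "K * \<bar>a * norm (x - p) - a * norm (y - p)\<bar> \<le> K * (a * dist x y)"
    using \<open>0 \<le> K\<close> by (rule mult_left_mono)
  with h[of "a * norm (x - p)" "a * norm (y - p)"]
  show "dist (h (a * norm (x - p))) (h (a * norm (y - p))) \<le> K * a * dist x y"
    by (simp add: dist_real_def mult.assoc)
qed (use assms in simp)

text \<open>The dyadic dilates of \<open>tent\<close>, which is supported in [1/4, 1], sum up to 1 on the positive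
  half-line; \<open>plateau\<close> is a wider bump that equals 1 on [1/4, 1].\<close>

definition tent :: "real \<Rightarrow> real"
  where "tent t = max 0 (min (4 * t - 1) (2 - 2 * t))"

definition plateau :: "real \<Rightarrow> real"
  where "plateau t = max 0 (min 1 (min (8 * t - 1) (2 - t)))"

lemma tent_support: "tent t \<noteq> 0 \<Longrightarrow> t < 1"
  and plateau_support: "plateau t \<noteq> 0 \<Longrightarrow> 1 / 8 < t \<and> t < 2"
  by (auto simp: tent_def plateau_def max_def min_def split: if_splits)

lemma tent_simps:
  "\<bar>tent t\<bar> \<le> 1" "tent 0 = 0" "\<bar>tent s - tent t\<bar> \<le> 4 * \<bar>s - t\<bar>" "plateau t * tent t = tent t"
  by (auto simp: tent_def plateau_def max_def min_def abs_if)

lemma plateau_simps: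
  "\<bar>plateau t\<bar> \<le> 1" "plateau 0 = 0" "\<bar>plateau s - plateau t\<bar> \<le> 8 * \<bar>s - t\<bar>"
  by (auto simp: plateau_def max_def min_def abs_if)

lemma powi_floor_log:
  fixes t :: real
  assumes "0 < t"
  shows "2 powi \<lfloor>log 2 t\<rfloor> \<le> t" "t < 2 * 2 powi \<lfloor>log 2 t\<rfloor>"
  using floor_log_eq_powr_iff[of t 2 "\<lfloor>log 2 t\<rfloor>"] assms
  by (simp_all add: powr_add flip: powr_real_of_int')

text \<open>The support bounds 1/8 and 2 give t/2 < 2^n < 8t, while 2^m \<le> t < 2^(m+1) for the
  floor m of the logarithm of t.\<close>

lemma plateau_scales:
  fixes t :: real
  assumes "plateau (2 powi (-n) * t) \<noteq> 0" "0 \<le> t"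
  shows "n \<in> {\<lfloor>log 2 t\<rfloor>..\<lfloor>log 2 t\<rfloor> + 3}"
proof -
  let ?m = "\<lfloor>log 2 t\<rfloor>"
  have p: "1 / 8 < 2 powi (-n) * t" "2 powi (-n) * t < 2"
    using plateau_support[OF assms(1)] by auto
  then have "0 < t" using assms(2) by (cases "t = 0") auto
  note m = powi_floor_log[OF this]
  have "\<not> n < ?m"
  proof
    assume "n < ?m"
    then have "(2::real) powi (n + 1) \<le> 2 powi ?m" by (intro power_int_increasing) auto
    with m(1) p(2) show False by (simp add: power_int_add power_int_minus field_simps)
  qed
  moreover have "\<not> ?m + 3 < n"
  proof
    assume "?m + 3 < n"
    then have "(2::real) powi (?m + 4) \<le> 2 powi n" by (intro power_int_increasing) auto
    with m(2) p(1) show False by (simp add: power_int_add power_int_minus field_simps)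
  qed
  ultimately show ?thesis by simp
qed

lemma sum_tent_scales:
  fixes t :: real
  assumes "0 < t"
  shows "(\<Sum>n\<in>{\<lfloor>log 2 t\<rfloor>..\<lfloor>log 2 t\<rfloor> + 3}. tent (2 powi (-n) * t)) = 1"
proof -
  define m where "m = \<lfloor>log 2 t\<rfloor>"
  define s where "s = 2 powi (-m) * t"
  have s: "1 \<le> s" "s < 2"
    using powi_floor_log[OF assms] by (simp_all add: s_def m_def power_int_minus field_simps)
  have set: "{m..m + 3} = {m, m + 1, m + 2, m + 3}" by auto
  have scale: "2 powi (- m - 1) * t = s / 2" "2 powi (- m - 2) * t = s / 4"
    "2 powi (- m - 3) * t = s / 8"
    unfolding s_def by (simp_all add: power_int_diff)
  \<comment> \<open>For s in [1, 2) the first and last tents vanish, and the middle two are 2 - s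
    and s - 1.\<close>
  have "tent s + (tent (s / 2) + (tent (s / 4) + tent (s / 8))) = 1"
    using s by (simp add: tent_def max_def min_def)
  then show ?thesis
    by (simp add: set scale flip: m_def s_def)
qed

section \<open>Encoding a sequence of functions in one function\<close>

locale unit_vector =
  fixes e :: "'x::{real_normed_vector, pointed_metric_space}"
  assumes norm_e: "norm e = 1"
begin

text \<open>Spacing 4 along a ray that starts at distance 4 from the base point makes the balls of
  radius 2 pairwise disjoint and keeps the base point outside all of them.\<close>

definition centre :: "nat \<times> int \<Rightarrow> 'x"
  where "centre i = basepoint + (4 * (1 + real (to_nat i))) *\<^sub>R e"

text \<open>Radius 2, although stacked pieces only reach radius 1: \<open>unstack\<close> also reads
  at points up to distance 2, where no other piece may interfere.\<close>

definition near :: "'x \<Rightarrow> (nat \<times> int) set"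
  where "near z = {i. dist z (centre i) < 2}"

text \<open>A window containing every scale whose plateau is nonzero at \<open>x\<close>. The
  default value of the logarithm at the base point is harmless since
  \<open>plateau 0 = 0\<close>.\<close>

definition scales :: "'x \<Rightarrow> int set"
  where "scales x = (let m = \<lfloor>log 2 (norm (x - basepoint))\<rfloor> in {m..m + 3})"

text \<open>At most one ball is near a given point, so the sum in \<open>stack\<close> has at most one term.\<close>

definition stack :: "(nat \<Rightarrow> 'x \<Rightarrow> real) \<Rightarrow> 'x \<Rightarrow> real"
  where "stack F z = (\<Sum>i\<in>near z. tent (norm (z - centre i)) *
    (2 powi (- snd i) * F (fst i) (basepoint + (2 powi snd i) *\<^sub>R (z - centre i))))"

text \<open>The wider bump localises without altering what was stored, as
  \<open>plateau t * tent t = tent t\<close>. Subtracting the value at the centre makes the second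
  factor vanish at the base point, as the patching bound requires.\<close>

definition unstack :: "nat \<Rightarrow> ('x \<Rightarrow> real) \<Rightarrow> 'x \<Rightarrow> real"
  where "unstack k g x = (\<Sum>n\<in>scales x. plateau (2 powi (-n) * norm (x - basepoint)) *
    (2 powi n * (g (centre (k, n) + (2 powi (-n)) *\<^sub>R (x - basepoint)) - g (centre (k, n)))))"

lemma dist_centre:
  assumes "i \<noteq> j"
  shows "4 \<le> dist (centre i) (centre j)"
proof -
  have "dist (centre i) (centre j) = \<bar>4 * real (to_nat i) - 4 * real (to_nat j)\<bar>"
    by (simp add: centre_def dist_norm norm_e flip: scaleR_diff_left)
  moreover have "to_nat i \<noteq> to_nat j" using assms by simp
  ultimately show ?thesis by linarith
qed

lemma near_eq:
  assumes "i \<in> near z"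
  shows "near z = {i}"
proof -
  have "j = i" if "j \<in> near z" for j
  proof (rule ccontr)
    assume "j \<noteq> i"
    then show False
      using dist_centre[of j i] dist_triangle2[of "centre j" "centre i" z] assms that
      by (simp add: near_def dist_commute)
  qed
  with assms show ?thesis by blast
qed

lemma near_cases: "near z = {} \<or> (\<exists>i. near z = {i})"
  using near_eq by blast

lemma near_basepoint: "near basepoint = {}"
  by (auto simp: near_def centre_def dist_norm norm_e)

lemma stack_add: "stack (F + G) = stack F + stack G"
  by (simp add: stack_def fun_eq_iff sum.distrib algebra_simps)

lemma unstack_add: "unstack k (f + g) = unstack k f + unstack k g"
  by (simp add: unstack_def fun_eq_iff algebra_simps flip: sum.distrib)

lemma stack_basepoint [simp]: "stack F basepoint = 0"
  by (simp add: stack_def near_basepoint)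

lemma unstack_basepoint [simp]: "unstack k g basepoint = 0"
  by (simp add: unstack_def plateau_simps)

text \<open>Inside the ball \<open>(k, n)\<close> the stack is the single tent piece of that index.
  The factors 2^n and 2^(-n) cancel, the tent swallows the plateau, and the tents sum up to
  1.\<close>

lemma unstack_stack:
  assumes "F k basepoint = 0"
  shows "unstack k (stack F) = F k"
proof
  fix x
  have centre: "stack F (centre (k, n)) = 0" for n
    using near_eq[of "(k, n)" "centre (k, n)"] by (simp add: stack_def near_def tent_simps)
  have val: "stack F (centre (k, n) + (2 powi (-n)) *\<^sub>R (x - basepoint)) =
      tent (2 powi (-n) * norm (x - basepoint)) * (2 powi (-n) * F k x)"
    if "2 powi (-n) * norm (x - basepoint) < 2" for n
  proof -
    have "(k, n) \<in> near (centre (k, n) + (2 powi (-n)) *\<^sub>R (x - basepoint))"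
      using that by (simp add: near_def dist_norm)
    from near_eq[OF this] show ?thesis
      by (simp add: stack_def power_int_minus)
  qed
  have "unstack k (stack F) x =
      (\<Sum>n\<in>scales x. tent (2 powi (-n) * norm (x - basepoint)) * F k x)"
    unfolding unstack_def
  proof (rule sum.cong)
    fix n
    let ?t = "2 powi (-n) * norm (x - basepoint)"
    show "plateau ?t * (2 powi n * (stack F (centre (k, n) + (2 powi (-n)) *\<^sub>R (x - basepoint))
        - stack F (centre (k, n)))) = tent ?t * F k x"
    proof (cases "?t < 2")
      case True
      have "plateau ?t * (2 powi n * (tent ?t * (2 powi (-n) * F k x))) = plateau ?t * tent ?t * F k x"
        by (simp add: power_int_minus)
      then show ?thesis by (simp only: val[OF True] centre tent_simps(4) diff_0_right)
    next
      case False
      then have "plateau ?t = 0" using plateau_support[of ?t] by auto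
      moreover from False have "tent ?t = 0" using tent_support[of ?t] by auto
      ultimately show ?thesis by simp
    qed
  qed simp
  also have "\<dots> = F k x"
    using assms sum_tent_scales[of "norm (x - basepoint)"]
    by (cases "x = basepoint") (simp_all add: scales_def Let_def flip: sum_distrib_right)
  finally show "unstack k (stack F) x = F k x" .
qed

text \<open>The constant is \<open>2 * 1 * (4 + 1)\<close>: one ball at a time, and
  \<open>tent\<close> has slope at most 4 on radius 1.\<close>

lemma lipschitz_on_stack:
  assumes "\<And>k. L-lipschitz_on UNIV (F k)" "\<And>k. F k basepoint = 0"
  shows "(10 * L)-lipschitz_on UNIV (stack F)"
proof -
  have "(2 * real 1 * (4 + 1) * L)-lipschitz_on UNIV (stack F)"
    unfolding stack_def
  proof (rule lipschitz_on_patch[where p = centre and r = "\<lambda>_. 1"])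
    show "finite (near z)" "card (near z) \<le> 1" for z using near_cases[of z] by auto
    show "(4 / 1)-lipschitz_on UNIV (\<lambda>z. tent (norm (z - centre i)))" for i
      using lipschitz_on_radial[of tent 4 1 "centre i", OF tent_simps(3)] by simp
    show "L-lipschitz_on UNIV (\<lambda>z. 2 powi (- snd i) *
        F (fst i) (basepoint + (2 powi snd i) *\<^sub>R (z - centre i)))" for i
      using lipschitz_on_dilation[OF assms(1)[of "fst i"], of "2 powi (- snd i)" "2 powi snd i"
          basepoint "centre i" 0]
      by (simp add: power_int_minus)
    show "i \<in> near z \<and> dist z (centre i) \<le> 1" if "tent (norm (z - centre i)) \<noteq> 0" for i z
      using tent_support[OF that] by (simp add: near_def dist_norm)
  qed (auto simp: tent_simps assms)
  then show ?thesis by simp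
qed

text \<open>The constant is \<open>2 * 4 * (16 + 1)\<close>: four scales at a time, and slope 8 on
  support radius 2 gives \<open>K = 16\<close> in the form \<open>K / r\<close>.\<close>

lemma lip0_op_unstack: "lip0_op 136 (unstack k)"
  unfolding lip0_op_def
proof (intro conjI allI impI)
  show "finitary (\<lambda>f. unstack k f x)" for x
    unfolding unstack_def by (intro finitary_sum finitary.scale finitary_diff finitary.eval)
  fix L and g :: "'x \<Rightarrow> real"
  assume g: "L-lipschitz_on UNIV g"
  have inverse: "2 powi n * 2 powi (-n) = (1 :: real)" for n :: int
    by (simp add: power_int_minus)
  have scale: "16 / (2 * 2 powi n) = (8 :: real) * 2 powi (-n)" for n :: int
    by (subst power_int_minus) (simp add: inverse_eq_divide)
  have "(2 * real 4 * (16 + 1) * L)-lipschitz_on UNIV (unstack k g)"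
    unfolding unstack_def
  proof (rule lipschitz_on_patch[where p = "\<lambda>_. basepoint" and r = "\<lambda>n. 2 * 2 powi n"])
    show "finite (scales x)" "card (scales x) \<le> 4" for x by (simp_all add: scales_def Let_def)
    show "(16 / (2 * 2 powi n))-lipschitz_on UNIV (\<lambda>x :: 'x. plateau (2 powi (-n) * norm (x - basepoint)))" for n
      using lipschitz_on_radial[of plateau 8 "2 powi (-n)" "basepoint :: 'x", OF plateau_simps(3)]
      unfolding scale by simp
    show "L-lipschitz_on UNIV (\<lambda>x. 2 powi n *
        (g (centre (k, n) + (2 powi (-n)) *\<^sub>R (x - basepoint)) - g (centre (k, n))))" for n
      by (rule lipschitz_on_dilation[OF g inverse]) simp
    show "n \<in> scales x \<and> dist x basepoint \<le> 2 * 2 powi n"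
      if "plateau (2 powi (-n) * norm (x - basepoint)) \<noteq> 0" for n x
    proof
      show "n \<in> scales x" using plateau_scales[OF that] by (simp add: scales_def Let_def)
      have "2 powi (-n) * norm (x - basepoint) < 2" using plateau_support[OF that] by blast
      then have "2 powi n * (2 powi (-n) * norm (x - basepoint)) \<le> 2 powi n * 2"
        by (intro mult_left_mono) simp_all
      moreover have "2 powi n * (2 powi (-n) * norm (x - basepoint)) = norm (x - basepoint)"
        by (simp only: inverse mult_1 mult.assoc[symmetric])
      ultimately show "dist x basepoint \<le> 2 * 2 powi n" by (simp add: dist_norm)
    qed
  qed (auto simp: plateau_simps)
  then show "(136 * L)-lipschitz_on UNIV (unstack k g)" by simp
qed simp_all

lemma lip0_op_stack:
  assumes "\<And>k. lip0_op C (T k)"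
  shows "lip0_op (10 * C) (\<lambda>f. stack (\<lambda>k. T k f))"
  unfolding lip0_op_def
proof (intro conjI allI impI)
  show "0 \<le> 10 * C" using lip0_op_nonneg[OF assms] by simp
  show "finitary (\<lambda>f. stack (\<lambda>k. T k f) x)" for x
    unfolding stack_def
    by (intro finitary_sum finitary.scale lip0_op_finitary[OF assms])
  show "(10 * C * L)-lipschitz_on UNIV (stack (\<lambda>k. T k f))"
    if "L-lipschitz_on UNIV f" "f basepoint = 0" for L f
    unfolding mult.assoc
    by (rule lipschitz_on_stack) (rule lip0_op_lipschitz[OF assms that] lip0_op_basepoint[OF assms that])+
qed simp


section \<open>Decomposition\<close>

text \<open>With V the functions on X, W those on M, and W embedded into V by \<open>pull q\<close> with left inverse
  \<open>pull j\<close>, V contains a sequence of copies of W. \<open>peel\<close> removes the W-component of the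
  first copy and shifts the others down by one place, \<open>absorb\<close> undoes this. So
  \<open>f \<mapsto> (peel j q f, pull j (unstack 0 f))\<close> is an isomorphism from V onto \<open>V \<times> W\<close>.\<close>

definition peel :: "('y::pointed_metric_space \<Rightarrow> 'x) \<Rightarrow> ('x \<Rightarrow> 'y) \<Rightarrow> ('x \<Rightarrow> real) \<Rightarrow> 'x \<Rightarrow> real"
  where "peel j q f = f +
    stack (\<lambda>k. pull q (pull j (unstack (Suc k) f)) - pull q (pull j (unstack k f)))"

text \<open>Adding the stack of new minus old contents overwrites the W-parts of the coordinates and
  leaves the rest of \<open>f\<close> in place.\<close>

definition absorb ::
    "('y::pointed_metric_space \<Rightarrow> 'x) \<Rightarrow> ('x \<Rightarrow> 'y) \<Rightarrow> ('y \<Rightarrow> real) \<Rightarrow> ('x \<Rightarrow> real) \<Rightarrow> 'x \<Rightarrow> real"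
  where "absorb j q w f = f +
    stack (\<lambda>k. (case k of 0 \<Rightarrow> pull q w | Suc m \<Rightarrow> pull q (pull j (unstack m f)))
      - pull q (pull j (unstack k f)))"

lemma stack_zero: "stack (\<lambda>k. 0) = 0"
  by (simp add: stack_def fun_eq_iff)

lemma stack_cancel:
  assumes "\<And>k. F k + G k = 0"
  shows "stack F + stack G = 0"
proof -
  have "F + G = (\<lambda>k. 0)" using assms by (simp add: fun_eq_iff)
  then show ?thesis by (simp add: stack_zero flip: stack_add)
qed

lemma peel_basepoint: "f basepoint = 0 \<Longrightarrow> peel j q f basepoint = 0"
  and absorb_basepoint: "f basepoint = 0 \<Longrightarrow> absorb j q w f basepoint = 0"
  by (simp_all add: peel_def absorb_def)

context
  fixes j :: "'y::pointed_metric_space \<Rightarrow> 'x" and q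
  assumes q_j: "\<And>y. q (j y) = y"
begin

text \<open>\<open>unstack k\<close> reads off the k-th difference, \<open>pull j\<close> undoes
  \<open>pull q\<close>, and the old k-th coordinate cancels.\<close>

lemma pull_unstack_peel: "pull j (unstack k (peel j q f)) = pull j (unstack (Suc k) f)"
  by (simp add: peel_def unstack_add unstack_stack pull_add pull_diff pull_pull q_j)

lemma pull_unstack_absorb:
  assumes "w basepoint = 0"
  shows "pull j (unstack k (absorb j q w f)) = (case k of 0 \<Rightarrow> w | Suc m \<Rightarrow> pull j (unstack m f))"
  using assms
  by (cases k) (simp_all add: absorb_def unstack_add unstack_stack pull_add pull_diff pull_pull q_j)

lemma absorb_peel: "absorb j q (pull j (unstack 0 f)) (peel j q f) = f"
proof -
  have "absorb j q (pull j (unstack 0 f)) (peel j q f) = f + (stack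
      (\<lambda>k. pull q (pull j (unstack (Suc k) f)) - pull q (pull j (unstack k f)))
    + stack (\<lambda>k. (case k of 0 \<Rightarrow> pull q (pull j (unstack 0 f)) |
        Suc m \<Rightarrow> pull q (pull j (unstack (Suc m) f))) - pull q (pull j (unstack (Suc k) f))))"
    unfolding absorb_def pull_unstack_peel by (simp add: peel_def add.assoc)
  also have "\<dots> = f"
    by (subst stack_cancel) (auto split: nat.split)
  finally show ?thesis .
qed

lemma peel_absorb:
  assumes "w basepoint = 0"
  shows "peel j q (absorb j q w f) = f"
proof -
  have "peel j q (absorb j q w f) = f + (stack
      (\<lambda>k. (case k of 0 \<Rightarrow> pull q w | Suc m \<Rightarrow> pull q (pull j (unstack m f)))
        - pull q (pull j (unstack k f)))
    + stack (\<lambda>k. pull q (pull j (unstack k f)) - pull q (case k of 0 \<Rightarrow> w | Suc m \<Rightarrow> pull j (unstack m f))))"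
    unfolding peel_def pull_unstack_absorb[where w = w, OF assms] by (simp add: absorb_def add.assoc)
  also have "\<dots> = f"
    by (subst stack_cancel) (auto split: nat.split)
  finally show ?thesis .
qed

end

lemma lip0_op_pull_pull_unstack:
  assumes "A-lipschitz_on UNIV j" "B-lipschitz_on UNIV q" "lip0_op C T"
  shows "lip0_op (B * (A * (136 * C))) (\<lambda>f. pull q (pull j (unstack k (T f))))"
  by (rule lip0_op_compose[OF lip0_op_pull[OF assms(2)]
        lip0_op_compose[OF lip0_op_pull[OF assms(1)] lip0_op_compose[OF lip0_op_unstack assms(3)]]])

lemma lip0_op_peel:
  assumes "A-lipschitz_on UNIV j" "B-lipschitz_on UNIV q" "lip0_op C T"
  shows "\<exists>D. lip0_op D (\<lambda>f. peel j q (T f))"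
proof -
  have "lip0_op (B * (A * (136 * C)) + B * (A * (136 * C)))
      (\<lambda>f. pull q (pull j (unstack (Suc k) (T f))) - pull q (pull j (unstack k (T f))))" for k
    by (rule lip0_op_diff; rule lip0_op_pull_pull_unstack[OF assms])
  note stack = lip0_op_stack[where T = "\<lambda>k f.
      pull q (pull j (unstack (Suc k) (T f))) - pull q (pull j (unstack k (T f)))", OF this]
  from lip0_op_add[OF assms(3) stack] show ?thesis unfolding peel_def by blast
qed

lemma lip0_op_absorb:
  assumes "A-lipschitz_on UNIV j" "B-lipschitz_on UNIV q" "lip0_op C T" "lip0_op D W"
  shows "\<exists>D. lip0_op D (\<lambda>f. absorb j q (W f) (T f))"
proof -
  \<comment> \<open>One bound for both branches, since the bound on stacked operators must not
    depend on \<open>k\<close>.\<close>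
  define K where "K = max (B * D) (B * (A * (136 * C)))"
  have "lip0_op K (\<lambda>f. case k of 0 \<Rightarrow> pull q (W f) | Suc m \<Rightarrow> pull q (pull j (unstack m (T f))))" for k
    by (cases k)
      (auto simp: K_def intro: lip0_op_mono[OF lip0_op_compose[OF lip0_op_pull[OF assms(2)] assms(4)]]
        lip0_op_mono[OF lip0_op_pull_pull_unstack[OF assms(1-3)]])
  then have "lip0_op (K + B * (A * (136 * C)))
      (\<lambda>f. (case k of 0 \<Rightarrow> pull q (W f) | Suc m \<Rightarrow> pull q (pull j (unstack m (T f))))
        - pull q (pull j (unstack k (T f))))" for k
    by (rule lip0_op_diff) (rule lip0_op_pull_pull_unstack[OF assms(1-3)])
  note stack = lip0_op_stack[where T = "\<lambda>k f.
      (case k of 0 \<Rightarrow> pull q (W f) | Suc m \<Rightarrow> pull q (pull j (unstack m (T f))))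
        - pull q (pull j (unstack k (T f)))", OF this]
  from lip0_op_add[OF assms(3) stack] show ?thesis unfolding absorb_def by blast
qed

lemma lipschitz_free_isomorphic_of_mutual_retracts:
  fixes i :: "'x \<Rightarrow> 'm::pointed_metric_space" and j :: "'m \<Rightarrow> 'x"
  assumes lip: "A-lipschitz_on UNIV i" "B-lipschitz_on UNIV r" "C-lipschitz_on UNIV j" "D-lipschitz_on UNIV q"
    and r_i: "\<And>x. r (i x) = x" and q_j: "\<And>y. q (j y) = y"
  shows "(lipschitz_free :: ('x lip0 \<Rightarrow>\<^sub>L real) set) \<simeq>\<^sub>l\<^sub>i\<^sub>n (lipschitz_free :: ('m lip0 \<Rightarrow>\<^sub>L real) set)"
proof -
  have id: "1-lipschitz_on UNIV (\<lambda>x::'x. x)" by (simp add: lipschitz_on_def)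
  \<comment> \<open>T composes \<open>V \<cong> V \<times> W\<close> with \<open>V \<times> W \<cong> W\<close>. The latter splits W as \<open>V \<times> ker (pull i)\<close> and
    absorbs the extra factor V by \<open>V \<times> V \<cong> V\<close>. S is its inverse.\<close>
  define g where "g = (\<lambda>f. pull j (unstack 0 f))"
  \<comment> \<open>\<open>h f\<close> codes the pair of \<open>peel j q f\<close> and the V-part
    \<open>pull i (g f)\<close> of \<open>g f\<close>; with identity maps, \<open>absorb\<close>
    inserts a full copy of V. \<open>T\<close> then replaces the V-part of \<open>g f\<close> by
    \<open>h f\<close>.\<close>
  define h where "h = (\<lambda>f. absorb (\<lambda>x. x) (\<lambda>x. x) (pull i (g f)) (peel j q f))"
  define T where "T = (\<lambda>f. g f + pull r (h f - pull i (g f)))"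
  \<comment> \<open>For \<open>t = T f\<close>, coordinate 0 of \<open>pull i t\<close> is the
    original V-part of \<open>g f\<close>; putting it back in place of \<open>pull i t\<close>
    recovers \<open>g f\<close>.\<close>
  define u where "u = (\<lambda>t. t + pull r (pull (\<lambda>x. x) (unstack 0 (pull i t)) - pull i t))"
  define S where "S = (\<lambda>t. absorb j q (u t) (peel (\<lambda>x. x) (\<lambda>x. x) (pull i t)))"
  have g: "lip0_op (C * 136) g"
    unfolding g_def by (rule lip0_op_compose[OF lip0_op_pull[OF lip(3)] lip0_op_unstack])
  have ig: "lip0_op (A * (C * 136)) (\<lambda>f. pull i (g f))"
    by (rule lip0_op_compose[OF lip0_op_pull[OF lip(1)] g])
  obtain P where "lip0_op P (\<lambda>f. peel j q f)"
    using lip0_op_peel[OF lip(3,4) lip0_op_id] by blast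
  then obtain H where "lip0_op H h"
    unfolding h_def using lip0_op_absorb[OF id id _ ig] by blast
  then have T: "lip0_op (C * 136 + B * (H + A * (C * 136))) T"
    unfolding T_def
    by (intro lip0_op_add[OF g] lip0_op_compose[OF lip0_op_pull[OF lip(2)]] lip0_op_diff ig)
  have u: "lip0_op (1 + B * (1 * (136 * A) + A)) u"
    unfolding u_def
    by (intro lip0_op_add lip0_op_id lip0_op_compose[OF lip0_op_pull[OF lip(2)]] lip0_op_diff
        lip0_op_compose[OF lip0_op_pull[OF id]] lip0_op_compose[OF lip0_op_unstack] lip0_op_pull lip(1))
  obtain Q where "lip0_op Q (\<lambda>t. peel (\<lambda>x. x) (\<lambda>x. x) (pull i t))"
    using lip0_op_peel[OF id id lip0_op_pull[OF lip(1)]] by blast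
  then obtain K where S: "lip0_op K S"
    unfolding S_def using lip0_op_absorb[OF lip(3,4) _ u] by blast
  show ?thesis
  proof (rule lipschitz_free_isomorphic[OF T S])
    fix f :: "'x \<Rightarrow> real"
    assume f: "f basepoint = 0"
    have h: "h f basepoint = 0"
      by (simp add: h_def f peel_basepoint absorb_basepoint)
    \<comment> \<open>\<open>pull i\<close> undoes \<open>pull r\<close>, so the two occurrences of
      \<open>pull i (g f)\<close> cancel.\<close>
    have iT: "pull i (T f) = h f"
      by (simp add: T_def pull_add pull_pull r_i h)
    have "pull (\<lambda>x. x) (unstack 0 (h f)) = pull i (g f)"
      by (simp add: h_def pull_unstack_absorb)
    then have "u (T f) = g f"
      by (simp add: u_def iT) (simp add: T_def pull_diff)
    moreover have "peel (\<lambda>x. x) (\<lambda>x. x) (h f) = peel j q f"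
      by (simp add: h_def peel_absorb)
    ultimately show "S (T f) = f"
      by (simp add: S_def iT g_def absorb_peel q_j)
  next
    fix t :: "'m \<Rightarrow> real"
    assume t: "t basepoint = 0"
    let ?h = "pull i t"
    have u: "u t basepoint = 0" by (simp add: u_def t)
    have gS: "g (S t) = u t"
      by (simp add: g_def S_def pull_unstack_absorb q_j u)
    have iu: "pull i (u t) = pull (\<lambda>x. x) (unstack 0 ?h)"
      by (simp add: u_def pull_add pull_pull r_i)
    \<comment> \<open>\<open>peel j q\<close> undoes the outer \<open>absorb j q\<close>; what
      remains is the pair obtained by peeling \<open>?h\<close> itself, which \<open>absorb\<close>
      reassembles.\<close>
    have "h (S t) = ?h"
      unfolding h_def gS iu by (simp add: S_def peel_absorb absorb_peel q_j u)
    then show "T (S t) = t"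
      by (simp add: T_def gS iu) (simp add: u_def pull_diff)
  qed
qed

end

section \<open>From the hypotheses to Lipschitz maps with left inverses\<close>

text \<open>The left inverse is the retraction followed by the inverse of the equivalence, which is
  Lipschitz by the lower bound \<open>c\<close>.\<close>

lemma lipschitz_retract_factorisation:
  fixes N :: "'b::metric_space set"
  assumes "N lipschitz_retract_of UNIV" "lipschitz_equivalent (UNIV :: 'a::metric_space set) N"
  obtains A and i :: "'a::metric_space \<Rightarrow> 'b" and B r
  where "A-lipschitz_on UNIV i" "B-lipschitz_on UNIV r" "\<And>x. r (i x) = x"
proof -
  obtain p L where p: "L-lipschitz_on UNIV p" "range p = N" "\<And>y. y \<in> N \<Longrightarrow> p y = y"
    using assms(1) unfolding lipschitz_retract_of_def by auto
  obtain i :: "'a \<Rightarrow> 'b" where "bi_lipschitz_on UNIV i" and i: "range i = N"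
    using assms(2) unfolding lipschitz_equivalent_def by blast
  then obtain c C where c: "0 < c" "\<And>x y. c * dist x y \<le> dist (i x) (i y)"
    and C: "\<And>x y. dist (i x) (i y) \<le> C * dist x y"
    unfolding bi_lipschitz_on_def by auto
  have "inj i"
  proof (rule injI)
    fix x y assume "i x = i y"
    with c(2)[of x y] c(1) show "x = y" by (simp add: mult_le_0_iff)
  qed
  have inv: "i (inv i (p y)) = p y" for y
    using i p(2) by (metis f_inv_into_f rangeI)
  show ?thesis
  proof
    \<comment> \<open>\<open>C\<close> may be negative when the domain is a single point.\<close>
    show "\<bar>C\<bar>-lipschitz_on UNIV i"
      by (rule lipschitz_onI, rule order_trans[OF C mult_right_mono]) simp_all
    show "(L / c)-lipschitz_on UNIV (\<lambda>y. inv i (p y))"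
    proof (rule lipschitz_onI)
      fix x y
      have "c * dist (inv i (p x)) (inv i (p y)) \<le> L * dist x y"
        using c(2)[of "inv i (p x)" "inv i (p y)"] lipschitz_onD[OF p(1), of x y] by (simp add: inv)
      then show "dist (inv i (p x)) (inv i (p y)) \<le> L / c * dist x y"
        using c(1) by (simp add: field_simps)
    qed (use c(1) lipschitz_on_nonneg[OF p(1)] in simp)
    show "inv i (p (i x)) = x" for x
      using p(3)[of "i x"] i \<open>inj i\<close> by auto
  qed
qed

text \<open>Settles X = 0, which has no unit vector: functions vanishing at the base point are all
  0, so the zero operators are mutually inverse.\<close>

lemma lipschitz_free_isomorphic_of_singletons:
  assumes "\<And>x :: 'a::pointed_metric_space. x = basepoint" "\<And>y :: 'b::pointed_metric_space. y = basepoint"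
  shows "(lipschitz_free :: ('a::pointed_metric_space lip0 \<Rightarrow>\<^sub>L real) set) \<simeq>\<^sub>l\<^sub>i\<^sub>n
    (lipschitz_free :: ('b::pointed_metric_space lip0 \<Rightarrow>\<^sub>L real) set)"
proof (rule lipschitz_free_isomorphic)
  show "lip0_op 0 (\<lambda>(f :: 'a \<Rightarrow> real) (y :: 'b). 0)" "lip0_op 0 (\<lambda>(f :: 'b \<Rightarrow> real) (y :: 'a). 0)"
    by (auto simp: lip0_op_def intro: finitary.zero lipschitz_on_constant)
  show "(\<lambda>y. 0) = f" if "f basepoint = 0" for f :: "'a \<Rightarrow> real"
    using that assms(1) by (metis ext)
  show "(\<lambda>y. 0) = f" if "f basepoint = 0" for f :: "'b \<Rightarrow> real"
    using that assms(2) by (metis ext)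
qed

theorem corollary3p2:
  fixes N1 :: "'x::{banach, pointed_metric_space} set"
    and N2 :: "'m::pointed_metric_space set"
  assumes "N1 lipschitz_retract_of (UNIV :: 'x set)"
    and "N2 lipschitz_retract_of (UNIV :: 'm set)"
    and "lipschitz_equivalent (UNIV :: 'x set) N2"
    and "lipschitz_equivalent (UNIV :: 'm set) N1"
  shows "(lipschitz_free :: ('x lip0 \<Rightarrow>\<^sub>L real) set) \<simeq>\<^sub>l\<^sub>i\<^sub>n
    (lipschitz_free :: ('m lip0 \<Rightarrow>\<^sub>L real) set)"
proof -
  obtain A and i :: "'x \<Rightarrow> 'm" and B r
    where ir: "A-lipschitz_on UNIV i" "B-lipschitz_on UNIV r" "\<And>x. r (i x) = x"
    using lipschitz_retract_factorisation[OF assms(2,3)] by blast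
  obtain C and j :: "'m \<Rightarrow> 'x" and D q
    where jq: "C-lipschitz_on UNIV j" "D-lipschitz_on UNIV q" "\<And>y. q (j y) = y"
    using lipschitz_retract_factorisation[OF assms(1,4)] by blast
  show ?thesis
  proof (cases "\<exists>v :: 'x. v \<noteq> 0")
    case True
    then obtain v :: 'x where "v \<noteq> 0" by blast
    then interpret unit_vector "v /\<^sub>R norm v" by unfold_locales simp
    show ?thesis
      by (rule lipschitz_free_isomorphic_of_mutual_retracts[OF ir(1,2) jq(1,2) ir(3) jq(3)])
  next
    case False
    then have x: "x = y" for x y :: 'x by metis
    then have "x = y" for x y :: 'm using jq(3) by metis
    with x show ?thesis by (intro lipschitz_free_isomorphic_of_singletons)
  qed
qed

end
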